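(* Let $G=(V,E)$ be a cycle-disjoint directed graph and let $u,v\in V$ be two vertices. For $\Lambda\in\mathbb R^E$ and a noise vector $\varepsilon$, let $S=(s_{ij})$ and $T=(t_{ijk})$ be the second- and third-order moments of $X=(I-\Lambda)^{-T}\varepsilon$, and put $$d_{uv}^{2\times 2}=\det\begin{pmatrix}s_{uu}&s_{uv}\\ t_{uuu}&t_{uuv}\end{pmatrix},\qquad d_{uv}^{3\times 3}=\det\begin{pmatrix}s_{uu}&s_{uv}&s_{vv}\\t_{uuu}&t_{uuv}&t_{uvv}\\t_{uuv}&t_{uvv}&t_{vvv}\end{pmatrix}.$$ Then: (a) $d_{uv}^{2\times2}=0$ identically if and only if $u$ and $v$ have no common ancestors and $v$ is not an ancestor of $u$; (b) $d_{uv}^{3\times3}=0$ identically if and only if there exists no simple 2-trek $(P_u,P_v)$ between $u$ and $v$ with non-empty sides. Here "identically" means for any choice of $\Lambda\in\mathbb R^E$ and any distribution of the noise vector $\varepsilon$.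
   Context: A directed graph is cycle-disjoint if each of its nodes belongs to at most one directed cycle (2-cycles $i\to j\to i$ are allowed). $\mathbb R^E$ is the set of real $|V|\times|V|$ matrices $\Lambda=(\lambda_{ij})$ with $I-\Lambda$ invertible and $\lambda_{ij}=0$ whenever $i\to j\notin E$. A noise vector $\varepsilon=(\varepsilon_i)_{i\in V}$ is a centered random vector with independent components, positive variances and finite third moments (so its second- and third-order moment tensors are diagonal, the former positive definite). For $X=(I-\Lambda)^{-T}\varepsilon$, where $M^{-T}=(M^{-1})^T$, set $s_{ij}=\mathbb E[X_iX_j]$ and $t_{ijk}=\mathbb E[X_iX_jX_k]$. The ancestors of a node $b$ are the nodes $a$ with a directed path (of length at least $0$) from $a$ to $b$. A 2-trek between $u$ and $v$ is a pair of directed paths $\tau=(P_u,P_v)$ with a common source $\mathrm{top}(\tau)$ and sinks $u$ and $v$, respectively. It is simple if the only common vertex of $P_u$ and $P_v$ is $\mathrm{top}(\tau)$. It has non-empty sides if both $P_u$ and $P_v$ are non-empty, i.e. $\mathrm{top}(\tau)\ne u$ and $\mathrm{top}(\tau)\neq v$.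
   Formalization: In (a), "common ancestor" of u and v is taken to mean a node with a directed path to u avoiding v and a directed path to v avoiding u; read literally, (a) fails for the graph u→v. The two vertices u and v are taken to be distinct. *)

theory Defs
  imports "HOL-Probability.Probability" "Graph_Theory.Graph_Theory"
begin

section \<open>Graphs\<close>

text \<open>
  A cycle of \<^theory>\<open>Graph_Theory.Arc_Walk\<close> is a closed walk with a chosen starting point.  Two
  such walks are rotations of each other, i.e. describe the same directed cycle, iff they
  have the same set of arcs.
\<close>

definition cycle_disjoint :: "'n pair_pre_digraph \<Rightarrow> bool" where
  "cycle_disjoint G \<longleftrightarrow>
     (\<forall>w p q. pre_digraph.cycle G p \<and> pre_digraph.cycle G q \<and>
        w \<in> set (pre_digraph.awalk_verts G (fst (hd p)) p) \<and>
        w \<in> set (pre_digraph.awalk_verts G (fst (hd q)) q) \<longrightarrow> set p = set q)"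

definition ancestor :: "'n pair_pre_digraph \<Rightarrow> 'n \<Rightarrow> 'n \<Rightarrow> bool" where
  "ancestor G a b \<longleftrightarrow> (\<exists>p. pre_digraph.apath G a p b)"

text \<open>
  ``\<open>u\<close> and \<open>v\<close> have no common ancestors'' is read as the absence of a confounder: neither of
  the two paths from \<open>a\<close> may run through the other node; in particular \<open>a\<close> differs from \<open>u\<close>
  and \<open>v\<close>.  It cannot mean that no node satisfies both \<open>ancestor G a u\<close> and
  \<open>ancestor G a v\<close>.  If \<open>u \<rightarrow> v\<close> is the only edge, then \<open>u\<close> is such a node, but
  \<open>X\<^sub>v = \<lambda> X\<^sub>u + \<epsilon>\<^sub>v\<close> gives \<open>s\<^sub>u\<^sub>v = \<lambda> s\<^sub>u\<^sub>u\<close> and \<open>t\<^sub>u\<^sub>u\<^sub>v = \<lambda> t\<^sub>u\<^sub>u\<^sub>u\<close>,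
  so the 2 x 2 determinant vanishes identically.  Excluding only \<open>u\<close> and \<open>v\<close> themselves is
  not enough: the same computation applies to \<open>c \<rightarrow> u \<rightarrow> v\<close>.
\<close>

definition common_ancestor :: "'n pair_pre_digraph \<Rightarrow> 'n \<Rightarrow> 'n \<Rightarrow> 'n \<Rightarrow> bool" where
  "common_ancestor G a u v \<longleftrightarrow>
     (\<exists>p. pre_digraph.apath G a p u \<and> v \<notin> set (pre_digraph.awalk_verts G a p)) \<and>
     (\<exists>q. pre_digraph.apath G a q v \<and> u \<notin> set (pre_digraph.awalk_verts G a q))"

text \<open>A 2-trek is given by its top \<open>t\<close> and the arc lists of its two sides.\<close>

definition two_trek ::
  "'n pair_pre_digraph \<Rightarrow> 'n \<Rightarrow> ('n \<times> 'n) awalk \<Rightarrow> ('n \<times> 'n) awalk \<Rightarrow> 'n \<Rightarrow> 'n \<Rightarrow> bool" where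
  "two_trek G t Pu Pv u v \<longleftrightarrow> pre_digraph.apath G t Pu u \<and> pre_digraph.apath G t Pv v"

definition simple_two_trek ::
  "'n pair_pre_digraph \<Rightarrow> 'n \<Rightarrow> ('n \<times> 'n) awalk \<Rightarrow> ('n \<times> 'n) awalk \<Rightarrow> 'n \<Rightarrow> 'n \<Rightarrow> bool" where
  "simple_two_trek G t Pu Pv u v \<longleftrightarrow> two_trek G t Pu Pv u v \<and>
     set (pre_digraph.awalk_verts G t Pu) \<inter> set (pre_digraph.awalk_verts G t Pv) = {t}"

section \<open>The model\<close>

definition edge_matrices :: "('n::finite) pair_pre_digraph \<Rightarrow> (real ^ 'n ^ 'n) set" where
  "edge_matrices G = {\<Lambda>. invertible (mat 1 - \<Lambda>) \<and> (\<forall>i j. (i, j) \<notin> parcs G \<longrightarrow> \<Lambda> $ i $ j = 0)}"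

text \<open>
  All moments depend only on the distribution of the noise vector, so a noise vector is
  represented by its law \<open>P\<close>, with the coordinate functions as its components.
\<close>

definition noise_law :: "(real ^ 'n::finite) measure \<Rightarrow> bool" where
  "noise_law P \<longleftrightarrow> prob_space P \<and> sets P = sets borel \<and>
     prob_space.indep_vars P (\<lambda>_. borel) (\<lambda>i \<epsilon>. \<epsilon> $ i) UNIV \<and>
     (\<forall>i. integrable P (\<lambda>\<epsilon>. \<bar>\<epsilon> $ i\<bar> ^ 3) \<and>
          prob_space.expectation P (\<lambda>\<epsilon>. \<epsilon> $ i) = 0 \<and>
          prob_space.variance P (\<lambda>\<epsilon>. \<epsilon> $ i) > 0)"

definition lsem :: "real ^ 'n ^ 'n \<Rightarrow> real ^ 'n \<Rightarrow> real ^ ('n::finite)" where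
  "lsem \<Lambda> \<epsilon> = transpose (matrix_inv (mat 1 - \<Lambda>)) *v \<epsilon>"

definition s_mom :: "real ^ 'n ^ 'n \<Rightarrow> (real ^ 'n::finite) measure \<Rightarrow> 'n \<Rightarrow> 'n \<Rightarrow> real" where
  "s_mom \<Lambda> P i j = prob_space.expectation P (\<lambda>\<epsilon>. lsem \<Lambda> \<epsilon> $ i * lsem \<Lambda> \<epsilon> $ j)"

definition t_mom :: "real ^ 'n ^ 'n \<Rightarrow> (real ^ 'n::finite) measure \<Rightarrow> 'n \<Rightarrow> 'n \<Rightarrow> 'n \<Rightarrow> real" where
  "t_mom \<Lambda> P i j k =
     prob_space.expectation P (\<lambda>\<epsilon>. lsem \<Lambda> \<epsilon> $ i * lsem \<Lambda> \<epsilon> $ j * lsem \<Lambda> \<epsilon> $ k)"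

definition d2x2 :: "real ^ 'n ^ 'n \<Rightarrow> (real ^ 'n::finite) measure \<Rightarrow> 'n \<Rightarrow> 'n \<Rightarrow> real" where
  "d2x2 \<Lambda> P u v =
     (let s = s_mom \<Lambda> P; t = t_mom \<Lambda> P in
      det (vector [vector [s u u, s u v],
                   vector [t u u u, t u u v]] :: real ^ 2 ^ 2))"

definition d3x3 :: "real ^ 'n ^ 'n \<Rightarrow> (real ^ 'n::finite) measure \<Rightarrow> 'n \<Rightarrow> 'n \<Rightarrow> real" where
  "d3x3 \<Lambda> P u v =
     (let s = s_mom \<Lambda> P; t = t_mom \<Lambda> P in
      det (vector [vector [s u u, s u v, s v v],
                   vector [t u u u, t u u v, t u v v],
                   vector [t u u v, t u v v, t v v v]] :: real ^ 3 ^ 3))"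

end

theory Submission
  imports Defs
begin

text \<open>
  Let \<open>A = (I - \<Lambda>)\<^sup>-\<^sup>1\<close> and write \<open>(a\<^sub>i, b\<^sub>i) = (A\<^sub>i\<^sub>u, A\<^sub>i\<^sub>v)\<close>.  By independence the moments
  are sums over the nodes \<open>i\<close> of the corresponding monomials in \<open>a\<^sub>i, b\<^sub>i\<close>, weighted with the
  second or third moments of the noise.  So the \<open>3 \<times> 3\<close> matrix is singular as soon as some nonzero
  binary quadratic form vanishes at all \<open>(a\<^sub>i, b\<^sub>i)\<close>, and the \<open>2 \<times> 2\<close> matrix as soon as such a form
  divisible by its first variable does.

  If every path from \<open>i\<close> to \<open>v\<close> runs through \<open>u\<close>, then \<open>(a\<^sub>i, b\<^sub>i)\<close> is annihilated by a nonzero linear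
  form that is the same for all such \<open>i\<close>; this holds for every \<open>\<Lambda>\<close>, also where \<open>A\<^sub>u\<^sub>u = 0\<close>.  Without
  a confounder each node is of this kind or of the kind with \<open>u\<close> and \<open>v\<close> exchanged, and the
  product of the two linear forms is the required quadratic form.  Conversely, the 0-1 matrix \<open>\<Lambda>\<close>
  supported on a simple trek, with noise that is skewed at suitable nodes only, gives a nonzero
  determinant.  Confounders and simple treks with non-empty sides correspond to each other:
  shorten the two paths until they meet only in their source.
\<close>

section \<open>Paths and treks\<close>

lemma (in pair_wf_digraph) apath_suffix:
  assumes "apath a p b" "w \<in> set (pawalk_verts a p)"
  shows "\<exists>q. apath w q b \<and> set (pawalk_verts w q) \<subseteq> set (pawalk_verts a p) \<and>
    length q \<le> length p \<and> (w \<noteq> a \<longrightarrow> length q < length p)"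
  using assms
proof (induction p arbitrary: a)
  case Nil
  then show ?case by (intro exI[of _ "[]"]) (auto simp: apath_Nil_iff)
next
  case (Cons e p)
  show ?case
  proof (cases "w = a")
    case True
    with Cons.prems show ?thesis by blast
  next
    case False
    from Cons.prems have "apath (snd e) p b" "w \<in> set (pawalk_verts (snd e) p)"
      using False by (auto simp: apath_Cons_iff)
    from Cons.IH[OF this] show ?thesis by fastforce
  qed
qed

text \<open>Prepending the arc would repeat \<open>a\<close> if \<open>a\<close> already lies on
  \<open>q\<close>; in that case the suffix of \<open>q\<close> from \<open>a\<close> is used. Hence
  the set of nodes with a path to \<open>v\<close> avoiding a node \<open>x\<close> is closed under
  predecessors other than \<open>x\<close>.\<close>

lemma (in pair_wf_digraph) apath_extend:
  assumes "(a, b) \<in> parcs G" "apath b q v"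
  shows "\<exists>p. apath a p v \<and> set (pawalk_verts a p) \<subseteq> insert a (set (pawalk_verts b q))"
proof (cases "a \<in> set (pawalk_verts b q)")
  case True
  from apath_suffix[OF assms(2) this] show ?thesis by blast
next
  case False
  with assms show ?thesis by (intro exI[of _ "(a, b) # q"]) (auto simp: apath_Cons_iff)
qed

lemma (in pair_wf_digraph) apath_ends_mem:
  assumes "apath a p b"
  shows "a \<in> set (pawalk_verts a p)" "b \<in> set (pawalk_verts a p)"
  using assms by (induction p arbitrary: a) (auto simp: apath_Nil_iff apath_Cons_iff)

lemma (in pair_wf_digraph) ex_common_ancestor_iff_simple_two_trek:
  "(\<exists>a. common_ancestor G a u v) \<longleftrightarrow>
   (\<exists>t Pu Pv. simple_two_trek G t Pu Pv u v \<and> Pu \<noteq> [] \<and> Pv \<noteq> [])"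
proof
  let ?P = "\<lambda>a p q. apath a p u \<and> v \<notin> set (pawalk_verts a p) \<and>
      apath a q v \<and> u \<notin> set (pawalk_verts a q)"
  assume "\<exists>a. common_ancestor G a u v"
  \<comment> \<open>The two paths are taken of least total length. A second common vertex would
    itself be a confounder, with strictly shorter suffixes as its paths.\<close>
  then have "\<exists>n a p q. ?P a p q \<and> length p + length q = n"
    by (auto simp: common_ancestor_def)
  from exists_least_iff[THEN iffD1, OF this] obtain a p q where
    p: "apath a p u" "v \<notin> set (pawalk_verts a p)" and
    q: "apath a q v" "u \<notin> set (pawalk_verts a q)" and
    min: "\<And>b p' q'. length p' + length q' < length p + length q \<Longrightarrow> \<not> ?P b p' q'"
    by blast
  have "w = a" if w: "w \<in> set (pawalk_verts a p)" "w \<in> set (pawalk_verts a q)" for w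
  proof (rule ccontr)
    assume "w \<noteq> a"
    with apath_suffix[OF p(1) w(1)] apath_suffix[OF q(1) w(2)] obtain p' q' where
      "apath w p' u" "set (pawalk_verts w p') \<subseteq> set (pawalk_verts a p)" "length p' < length p"
      "apath w q' v" "set (pawalk_verts w q') \<subseteq> set (pawalk_verts a q)" "length q' < length q"
      by blast
    with p q show False using min[of p' q' w] by auto
  qed
  moreover have "p \<noteq> []" "q \<noteq> []"
    using p q apath_ends_mem(1)[OF p(1)] apath_ends_mem(1)[OF q(1)] by (auto simp: apath_Nil_iff)
  ultimately have "simple_two_trek G a p q u v \<and> p \<noteq> [] \<and> q \<noteq> []"
    using p(1) q(1) apath_ends_mem(1)
    by (auto simp: simple_two_trek_def two_trek_def)
  then show "\<exists>t Pu Pv. simple_two_trek G t Pu Pv u v \<and> Pu \<noteq> [] \<and> Pv \<noteq> []" by blast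
next
  assume "\<exists>t Pu Pv. simple_two_trek G t Pu Pv u v \<and> Pu \<noteq> [] \<and> Pv \<noteq> []"
  then obtain t p q where pq: "apath t p u" "apath t q v" "p \<noteq> []" "q \<noteq> []"
    and int: "set (pawalk_verts t p) \<inter> set (pawalk_verts t q) = {t}"
    by (auto simp: simple_two_trek_def two_trek_def)
  have "t \<noteq> u" "t \<noteq> v" using pq apath_nonempty_ends by blast+
  moreover have "u \<in> set (pawalk_verts t p)" "v \<in> set (pawalk_verts t q)"
    using pq apath_ends_mem(2) by blast+
  ultimately have "v \<notin> set (pawalk_verts t p)" "u \<notin> set (pawalk_verts t q)"
    using int by auto
  with pq have "common_ancestor G t u v" by (auto simp: common_ancestor_def)
  then show "\<exists>a. common_ancestor G a u v" by blast
qed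

text \<open>Facts about the adjacency matrix of a path: each vertex but the sink has one outgoing
  arc, which gives the row sums, and no arc enters the source, which keeps apart two paths that meet
  only in their source.\<close>

lemma (in pair_wf_digraph) apath_arcs:
  assumes "apath a p b"
  shows "set p \<subseteq> parcs G" "set p \<subseteq> set (pawalk_verts a p) \<times> (set (pawalk_verts a p) - {a})"
    "\<And>w. card {w'. (w, w') \<in> set p} = (if w \<in> set (pawalk_verts a p) - {b} then 1 else 0)"
proof -
  have "set p \<subseteq> parcs G \<and> set p \<subseteq> set (pawalk_verts a p) \<times> (set (pawalk_verts a p) - {a}) \<and>
    (\<forall>w. card {w'. (w, w') \<in> set p} = (if w \<in> set (pawalk_verts a p) - {b} then 1 else 0))"
    using assms
  proof (induction p arbitrary: a)
    case Nil
    then show ?case by (auto simp: apath_Nil_iff)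
  next
    case (Cons e p)
    obtain c where e: "e = (a, c)" using Cons.prems by (cases e) (auto simp: apath_Cons_iff)
    have p: "apath c p b" "a \<notin> set (pawalk_verts c p)" "(a, c) \<in> parcs G"
      using Cons.prems e by (auto simp: apath_Cons_iff)
    note IH = Cons.IH[OF p(1)]
    have "{w'. (a, w') \<in> set (e # p)} = {c}" using IH p(2) e by auto
    moreover have "{w'. (w, w') \<in> set (e # p)} = {w'. (w, w') \<in> set p}" if "w \<noteq> a" for w
      using that e by auto
    moreover have "c \<in> set (pawalk_verts c p)" "b \<in> set (pawalk_verts c p)"
      using p(1) apath_ends_mem by blast+
    ultimately have "card {w'. (w, w') \<in> set (e # p)} =
        (if w \<in> set (pawalk_verts a (e # p)) - {b} then 1 else 0)" for w
      using IH p(2) e by (cases "w = a") auto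
    then show ?case using IH p(2,3) e apath_ends_mem(1)[OF p(1)] by auto
  qed
  then show "set p \<subseteq> parcs G" "set p \<subseteq> set (pawalk_verts a p) \<times> (set (pawalk_verts a p) - {a})"
    "\<And>w. card {w'. (w, w') \<in> set p} = (if w \<in> set (pawalk_verts a p) - {b} then 1 else 0)"
    by blast+
qed

lemma (in pair_wf_digraph) apath_rank:
  assumes "apath a p b"
  shows "\<exists>r :: 'a \<Rightarrow> nat. r a = 0 \<and> (\<forall>(x, y)\<in>set p. r x < r y)"
  using assms
proof (induction p arbitrary: a)
  case Nil
  then show ?case by auto
next
  case (Cons e p)
  obtain c where e: "e = (a, c)" using Cons.prems by (cases e) (auto simp: apath_Cons_iff)
  have p: "apath c p b" "a \<notin> set (pawalk_verts c p)"
    using Cons.prems e by (auto simp: apath_Cons_iff)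
  from Cons.IH[OF p(1)] obtain r :: "'a \<Rightarrow> nat" where "\<forall>(x, y)\<in>set p. r x < r y" by blast
  moreover have "c \<noteq> a" using p apath_ends_mem(1) by blast
  moreover have "x \<noteq> a \<and> y \<noteq> a" if "(x, y) \<in> set p" for x y
    using apath_arcs(2)[OF p(1)] p(2) that by blast
  \<comment> \<open>Raising all old ranks by one reserves rank 0 for the new source.\<close>
  ultimately show ?case
    using e by (intro exI[of _ "\<lambda>w. if w = a then 0 else Suc (r w)"]) auto
qed

section \<open>Linear algebra\<close>

text \<open>There is one unknown more than there are homogeneous equations. The map \<open>h\<close>
  turns this into a square system: off \<open>W\<close> it copies \<open>y\<close>, which forces the
  support, and its coordinate \<open>v\<close> is constantly 0, so it is not surjective and hence
  not injective.\<close>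

lemma ex_kernel_vector_supported_on:
  fixes B :: "real ^ 'n ^ 'n::finite"
  assumes "v \<in> W"
  shows "\<exists>y. y \<noteq> 0 \<and> (\<forall>w. w \<notin> W \<longrightarrow> y $ w = 0) \<and> (\<forall>w\<in>W - {v}. (B *v y) $ w = 0)"
proof -
  define h :: "real ^ 'n \<Rightarrow> real ^ 'n" where
    "h y = (\<chi> w. if w = v then 0 else if w \<in> W then (B *v y) $ w else y $ w)" for y
  have "linear h"
    by (intro linearI) (auto simp: h_def vec_eq_iff matrix_vector_right_distrib
        matrix_vector_mult_scaleR)
  have "\<not> surj h"
  proof
    assume "surj h"
    then obtain y where "h y = axis v 1" by (metis surjD)
    then have "h y $ v = 1" by simp
    then show False by (simp add: h_def)
  qed
  with \<open>linear h\<close> have "\<not> inj h" using linear_injective_imp_surjective by blast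
  with \<open>linear h\<close> obtain y where y: "h y = 0" "y \<noteq> 0"
    by (metis linear_injective_0)
  have *: "(if w = v then 0 else if w \<in> W then (B *v y) $ w else y $ w) = 0" for w
    using arg_cong[OF y(1), of "\<lambda>z. z $ w"] by (simp add: h_def)
  have "y $ w = 0" if "w \<notin> W" for w
    using *[of w] that assms by (auto split: if_splits)
  moreover have "(B *v y) $ w = 0" if "w \<in> W - {v}" for w
    using *[of w] that by auto
  ultimately show ?thesis using y(2) by blast
qed

text \<open>With the indices of \<open>R\<close> first, \<open>B\<close> is block upper triangular,
  so the equations in \<open>R\<close> can be solved with zeros elsewhere, and this is the only
  solution. The map \<open>h\<close> replaces the rows outside \<open>R\<close> by those of the
  identity, which keeps the system square.\<close>

lemma linear_solution_supported_on:
  fixes B :: "real ^ 'n ^ 'n::finite"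
  assumes inv: "invertible B" and R: "\<And>i j. i \<notin> R \<Longrightarrow> j \<in> R \<Longrightarrow> B $ i $ j = 0"
    and x: "B *v x = b" and b: "\<And>i. i \<notin> R \<Longrightarrow> b $ i = 0" and i: "i \<notin> R"
  shows "x $ i = 0"
proof -
  have injB: "y = z" if "B *v y = B *v z" for y z
    using that inv by (metis invertible_def matrix_vector_mul_assoc matrix_vector_mul_lid)
  define h :: "real ^ 'n \<Rightarrow> real ^ 'n" where
    "h y = (\<chi> w. if w \<in> R then (B *v y) $ w else y $ w)" for y
  have "linear h"
    by (intro linearI) (auto simp: h_def vec_eq_iff matrix_vector_right_distrib
        matrix_vector_mult_scaleR)
  have h: "B *v y = c" if "h y = c" and c: "\<And>i. i \<notin> R \<Longrightarrow> c $ i = 0" for y c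
  proof -
    have *: "(if w \<in> R then (B *v y) $ w else y $ w) = c $ w" for w
      using arg_cong[OF that(1), of "\<lambda>z. z $ w"] by (simp add: h_def)
    have "(B *v y) $ w = c $ w" for w
    proof (cases "w \<in> R")
      case False
      have "B $ w $ j * y $ j = 0" for j
        using *[of j] R[OF False, of j] c[of j] by (cases "j \<in> R") auto
      then show ?thesis using c[OF False] by (simp add: matrix_vector_mult_def sum.neutral)
    qed (use *[of w] in auto)
    then show ?thesis by (simp add: vec_eq_iff)
  qed
  have "inj h"
    unfolding linear_injective_0[OF \<open>linear h\<close>]
  proof (intro allI impI)
    fix y assume "h y = 0"
    then have "B *v y = 0" by (rule h) simp
    then show "y = 0" using injB[of y 0] by simp
  qed
  then have "surj h" using \<open>linear h\<close> linear_injective_imp_surjective by blast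
  then obtain y where y: "h y = b" by (metis surjD)
  then have "B *v y = b" using b by (rule h)
  then have "x = y" using x injB by simp
  then show ?thesis using arg_cong[OF y, of "\<lambda>z. z $ i"] b[OF i] i by (simp add: h_def)
qed

lemma matrix_inv_mult:
  fixes B :: "real ^ 'n ^ 'n::finite"
  assumes "invertible B"
  shows "B ** matrix_inv B = mat 1" "matrix_inv B ** B = mat 1"
  using someI_ex[OF assms[unfolded invertible_def]] by (auto simp: matrix_inv_def)

lemma matrix_inv_column:
  fixes B :: "real ^ 'n ^ 'n::finite"
  assumes "invertible B"
  shows "B *v column i (matrix_inv B) = axis i 1"
  using matrix_inv_mult(1)[OF assms]
  by (metis matrix_vector_mul_assoc matrix_vector_mul_lid matrix_vector_mult_basis)

lemma matrix_inv_column_unique: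
  fixes B :: "real ^ 'n ^ 'n::finite"
  assumes "invertible B" "B *v x = axis i 1"
  shows "matrix_inv B $ k $ i = x $ k"
proof -
  have "x = matrix_inv B *v axis i 1"
    using assms(2) matrix_inv_mult(2)[OF assms(1)]
    by (metis matrix_vector_mul_assoc matrix_vector_mul_lid)
  then show ?thesis by (simp add: matrix_vector_mult_basis column_def)
qed

text \<open>A kernel vector of the transpose expresses its entry at \<open>j\<close> through entries
  of smaller rank, so all entries vanish by induction on the rank.\<close>

lemma invertible_mat_minus_acyclic:
  fixes \<Lambda> :: "real ^ 'n ^ 'n::finite" and r :: "'n \<Rightarrow> nat"
  assumes r: "\<And>i j. \<Lambda> $ i $ j \<noteq> 0 \<Longrightarrow> r i < r j"
  shows "invertible (mat 1 - \<Lambda>)"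
proof -
  have "x = 0" if x: "transpose (mat 1 - \<Lambda>) *v x = 0" for x
  proof -
    have *: "x $ j = (\<Sum>i\<in>UNIV. \<Lambda> $ i $ j * x $ i)" for j
    proof -
      have "(transpose (mat 1 - \<Lambda>) *v x) $ j = 0" using x by simp
      then show ?thesis
        by (simp add: matrix_vector_mult_def transpose_def mat_def left_diff_distrib
            sum_subtractf if_distrib[where f = "\<lambda>a. a * _"] cong: if_cong)
    qed
    have "x $ j = 0" for j
    proof (induction "r j" arbitrary: j rule: less_induct)
      case less
      have "\<Lambda> $ i $ j * x $ i = 0" for i
        using less[of i] r[of i j] by (cases "\<Lambda> $ i $ j = 0") auto
      then show ?case by (subst *) (simp add: sum.neutral)
    qed
    then show ?thesis by (simp add: vec_eq_iff)
  qed
  then have "invertible (transpose (mat 1 - \<Lambda>))"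
    by (simp add: invertible_left_inverse matrix_left_invertible_ker)
  then show ?thesis by (metis transpose_invertible transpose_transpose)
qed

lemma det_eq_0_if_kernel:
  fixes M :: "real ^ 'm ^ 'm::finite"
  assumes "M *v c = 0" "c \<noteq> 0"
  shows "det M = 0"
  using assms by (metis invertible_det_nz invertible_left_inverse matrix_left_invertible_ker)

section \<open>Moments of the noise\<close>

lemma noise_law_monomial:
  fixes P :: "(real ^ 'n::finite) measure"
  assumes "noise_law P" and n: "\<And>i. n i \<le> 3"
  shows "integrable P (\<lambda>\<epsilon>. \<Prod>i\<in>UNIV. \<epsilon> $ i ^ n i)"
    and "(\<integral>\<epsilon>. (\<Prod>i\<in>UNIV. \<epsilon> $ i ^ n i) \<partial>P) = (\<Prod>i\<in>UNIV. \<integral>\<epsilon>. \<epsilon> $ i ^ n i \<partial>P)"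
proof -
  interpret prob_space P using assms by (simp add: noise_law_def)
  have [measurable_cong]: "sets P = sets borel" using assms by (simp add: noise_law_def)
  have ind: "indep_vars (\<lambda>_. borel) (\<lambda>i \<epsilon>. \<epsilon> $ i ^ n i) UNIV"
    by (rule indep_vars_compose2[where Y = "\<lambda>i x. x ^ n i"])
      (use assms in \<open>auto simp: noise_law_def\<close>)
  have int: "integrable P (\<lambda>\<epsilon>. \<epsilon> $ i ^ n i)" for i
  proof (rule Bochner_Integration.integrable_bound)
    show "integrable P (\<lambda>\<epsilon>. 1 + \<bar>\<epsilon> $ i\<bar> ^ 3)"
      using assms by (auto simp: noise_law_def)
    \<comment> \<open>The third absolute moment controls all lower powers; the summand 1 covers
      small values.\<close>
    have "\<bar>x\<bar> ^ n i \<le> 1 + \<bar>x\<bar> ^ 3" for x :: real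
    proof (cases "\<bar>x\<bar> \<le> 1")
      case True
      then show ?thesis
        using power_le_one[of "\<bar>x\<bar>" "n i"] by (smt (verit) zero_le_power abs_ge_zero)
    next
      case False
      then have "\<bar>x\<bar> ^ n i \<le> \<bar>x\<bar> ^ 3" by (intro power_increasing n) simp
      then show ?thesis by simp
    qed
    then show "AE \<epsilon> in P. norm (\<epsilon> $ i ^ n i) \<le> norm (1 + \<bar>\<epsilon> $ i\<bar> ^ 3)"
      by (simp add: power_abs)
  qed measurable
  show "integrable P (\<lambda>\<epsilon>. \<Prod>i\<in>UNIV. \<epsilon> $ i ^ n i)"
    by (rule indep_vars_integrable[OF _ ind]) (auto intro: int)
  show "(\<integral>\<epsilon>. (\<Prod>i\<in>UNIV. \<epsilon> $ i ^ n i) \<partial>P) = (\<Prod>i\<in>UNIV. \<integral>\<epsilon>. \<epsilon> $ i ^ n i \<partial>P)"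
    by (rule indep_vars_lebesgue_integral[OF _ ind]) (auto intro: int)
qed

lemma prod_power_indicator:
  "(\<Prod>i\<in>UNIV. x i ^ (if i = k then 1 else 0)) = (x (k::'n::finite) :: real)"
  by (simp add: if_distrib[where f = "\<lambda>n. _ ^ n"] cong: if_cong)

text \<open>Products of coordinates are rewritten as monomials whose exponents count how often each
  node occurs. By independence and zero means, such a monomial integrates to 0 as soon as one
  exponent is 1.\<close>

lemma noise_moments:
  fixes P :: "(real ^ 'n::finite) measure"
  assumes P: "noise_law P"
  shows noise_second_integrable: "integrable P (\<lambda>\<epsilon>. \<epsilon> $ k * \<epsilon> $ l)"
    and noise_third_integrable: "integrable P (\<lambda>\<epsilon>. \<epsilon> $ k * \<epsilon> $ l * \<epsilon> $ m)"
    and noise_second_moment: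
      "(\<integral>\<epsilon>. \<epsilon> $ k * \<epsilon> $ l \<partial>P) = (if k = l then \<integral>\<epsilon>. (\<epsilon> $ k)\<^sup>2 \<partial>P else 0)"
    and noise_third_moment: "(\<integral>\<epsilon>. \<epsilon> $ k * \<epsilon> $ l * \<epsilon> $ m \<partial>P) =
      (if k = l \<and> l = m then \<integral>\<epsilon>. \<epsilon> $ k ^ 3 \<partial>P else 0)"
proof -
  let ?I = "\<lambda>k i. if i = k then 1 else 0 :: nat"
  have mean: "(\<integral>\<epsilon>. \<epsilon> $ i \<partial>P) = 0" for i using P by (simp add: noise_law_def)
  have zero: "(\<Prod>i\<in>UNIV. \<integral>\<epsilon>. \<epsilon> $ i ^ n i \<partial>P) = 0" if "n j = 1" for n :: "'n \<Rightarrow> nat" and j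
    by (rule prod_zero) (use that mean in \<open>auto intro!: exI[of _ j]\<close>)
  have 2: "(\<lambda>\<epsilon>::real^'n. \<epsilon> $ k * \<epsilon> $ l) = (\<lambda>\<epsilon>. \<Prod>i\<in>UNIV. \<epsilon> $ i ^ (?I k i + ?I l i))"
    by (simp only: power_add prod.distrib prod_power_indicator)
  have 3: "(\<lambda>\<epsilon>::real^'n. \<epsilon> $ k * \<epsilon> $ l * \<epsilon> $ m) =
      (\<lambda>\<epsilon>. \<Prod>i\<in>UNIV. \<epsilon> $ i ^ (?I k i + ?I l i + ?I m i))"
    by (simp only: power_add prod.distrib prod_power_indicator)
  show "integrable P (\<lambda>\<epsilon>. \<epsilon> $ k * \<epsilon> $ l)"
    unfolding 2 by (rule noise_law_monomial(1)[OF P]) auto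
  show "integrable P (\<lambda>\<epsilon>. \<epsilon> $ k * \<epsilon> $ l * \<epsilon> $ m)"
    unfolding 3 by (rule noise_law_monomial(1)[OF P]) auto
  show "(\<integral>\<epsilon>. \<epsilon> $ k * \<epsilon> $ l \<partial>P) = (if k = l then \<integral>\<epsilon>. (\<epsilon> $ k)\<^sup>2 \<partial>P else 0)"
  proof (cases "k = l")
    case False
    then have "(\<Prod>i\<in>UNIV. \<integral>\<epsilon>. \<epsilon> $ i ^ (?I k i + ?I l i) \<partial>P) = 0"
      by (intro zero[of _ k]) simp
    with False show ?thesis
      unfolding 2 by (subst noise_law_monomial(2)[OF P]) auto
  qed (simp add: power2_eq_square)
  show "(\<integral>\<epsilon>. \<epsilon> $ k * \<epsilon> $ l * \<epsilon> $ m \<partial>P) =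
      (if k = l \<and> l = m then \<integral>\<epsilon>. \<epsilon> $ k ^ 3 \<partial>P else 0)"
  proof (cases "k = l \<and> l = m")
    case False
    \<comment> \<open>Among three indices that are not all equal, some node occurs exactly
      once.\<close>
    then have "\<exists>j. ?I k j + ?I l j + ?I m j = 1"
      by (cases "k = l"; cases "k = m"; cases "l = m") (auto intro: exI[of _ k] exI[of _ l] exI[of _ m])
    then obtain j where "?I k j + ?I l j + ?I m j = 1" ..
    then have "(\<Prod>i\<in>UNIV. \<integral>\<epsilon>. \<epsilon> $ i ^ (?I k i + ?I l i + ?I m i) \<partial>P) = 0" by (rule zero)
    with False show ?thesis
      unfolding 3 by (subst noise_law_monomial(2)[OF P]) auto
  qed (simp add: power3_eq_cube)
qed

section \<open>Moments of the model\<close>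

lemma lsem_nth: "lsem \<Lambda> \<epsilon> $ i = (\<Sum>k\<in>UNIV. matrix_inv (mat 1 - \<Lambda>) $ k $ i * \<epsilon> $ k)"
  by (simp add: lsem_def matrix_vector_mult_def transpose_def)

lemma s_mom_eq:
  assumes "noise_law P"
  shows "s_mom \<Lambda> P i j = (\<Sum>k\<in>UNIV. (\<integral>\<epsilon>. (\<epsilon> $ k)\<^sup>2 \<partial>P) *
    (matrix_inv (mat 1 - \<Lambda>) $ k $ i * matrix_inv (mat 1 - \<Lambda>) $ k $ j))"
proof -
  let ?A = "matrix_inv (mat 1 - \<Lambda>)"
  have "s_mom \<Lambda> P i j =
      (\<integral>\<epsilon>. (\<Sum>k\<in>UNIV. \<Sum>l\<in>UNIV. ?A $ k $ i * ?A $ l $ j * (\<epsilon> $ k * \<epsilon> $ l)) \<partial>P)"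
    by (simp add: s_mom_def lsem_nth sum_product mult_ac)
  also have "\<dots> = (\<Sum>k\<in>UNIV. \<Sum>l\<in>UNIV. ?A $ k $ i * ?A $ l $ j * (\<integral>\<epsilon>. \<epsilon> $ k * \<epsilon> $ l \<partial>P))"
    by (simp add: Bochner_Integration.integral_sum noise_second_integrable[OF assms])
  also have "\<dots> = (\<Sum>k\<in>UNIV. (\<integral>\<epsilon>. (\<epsilon> $ k)\<^sup>2 \<partial>P) * (?A $ k $ i * ?A $ k $ j))"
    by (simp add: noise_second_moment[OF assms] if_distrib mult_ac cong: if_cong)
  finally show ?thesis .
qed

lemma t_mom_eq:
  assumes "noise_law P"
  shows "t_mom \<Lambda> P i j l = (\<Sum>k\<in>UNIV. (\<integral>\<epsilon>. \<epsilon> $ k ^ 3 \<partial>P) *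
    (matrix_inv (mat 1 - \<Lambda>) $ k $ i * matrix_inv (mat 1 - \<Lambda>) $ k $ j *
      matrix_inv (mat 1 - \<Lambda>) $ k $ l))"
proof -
  let ?A = "matrix_inv (mat 1 - \<Lambda>)"
  have "t_mom \<Lambda> P i j l = (\<integral>\<epsilon>. (\<Sum>k\<in>UNIV. \<Sum>k'\<in>UNIV. \<Sum>k''\<in>UNIV.
      ?A $ k $ i * ?A $ k' $ j * ?A $ k'' $ l * (\<epsilon> $ k * \<epsilon> $ k' * \<epsilon> $ k'')) \<partial>P)"
  proof -
    have "(\<Sum>k\<in>UNIV. a k) * (\<Sum>k\<in>UNIV. b k) * (\<Sum>k\<in>UNIV. c k) =
        (\<Sum>k\<in>UNIV. \<Sum>k'\<in>UNIV. \<Sum>k''\<in>UNIV. a k * (b k' * c k''))" for a b c :: "'a \<Rightarrow> real"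
      by (simp only: mult.assoc, simp only: sum_product, simp only: sum_distrib_left)
    then show ?thesis by (simp add: t_mom_def lsem_nth mult_ac)
  qed
  also have "\<dots> = (\<Sum>k\<in>UNIV. \<Sum>k'\<in>UNIV. \<Sum>k''\<in>UNIV.
      ?A $ k $ i * ?A $ k' $ j * ?A $ k'' $ l * (\<integral>\<epsilon>. \<epsilon> $ k * \<epsilon> $ k' * \<epsilon> $ k'' \<partial>P))"
    by (simp add: Bochner_Integration.integral_sum noise_third_integrable[OF assms])
  also have "\<dots> = (\<Sum>k\<in>UNIV. \<Sum>k'\<in>UNIV. if k = k' then
      ?A $ k $ i * ?A $ k' $ j * ?A $ k' $ l * (\<integral>\<epsilon>. \<epsilon> $ k ^ 3 \<partial>P) else 0)"
    by (intro sum.cong refl)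
      (simp add: noise_third_moment[OF assms] if_distrib cong: if_cong)
  also have "\<dots> = (\<Sum>k\<in>UNIV. (\<integral>\<epsilon>. \<epsilon> $ k ^ 3 \<partial>P) * (?A $ k $ i * ?A $ k $ j * ?A $ k $ l))"
    by (simp add: mult_ac)
  finally show ?thesis .
qed

section \<open>Noise with prescribed skewness\<close>

lemma ex_noise_law_third_moments:
  fixes K :: "('n::finite) set"
  shows "\<exists>P :: (real ^ 'n) measure. noise_law P \<and>
    (\<forall>i. (\<integral>\<epsilon>. \<epsilon> $ i ^ 3 \<partial>P) = (if i \<in> K then 2 else 0))"
proof -
  \<comment> \<open>The \<open>i\<close>-th component takes the values \<open>c i\<close> and \<open>-1\<close>, with mean \<open>0\<close>, variance \<open>c i\<close> and third
    moment \<open>c i (c i - 1)\<close>.\<close>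
  define c :: "'n \<Rightarrow> real" where "c i = (if i \<in> K then 2 else 1)" for i
  define X where "X i f = (if f i then c i else - 1)" for i and f :: "'n \<Rightarrow> bool"
  \<comment> \<open>Success probability \<open>1 / (1 + c i)\<close> makes the mean zero. The value
    \<open>c i = 1\<close> gives a symmetric component, and \<open>c i = 2\<close> gives third
    moment 2.\<close>
  define Q where "Q = Pi_pmf (UNIV :: 'n set) False (\<lambda>i. bernoulli_pmf (1 / (1 + c i)))"
  define g where "g f = (\<chi> i. X i f)" for f
  define P where "P = distr (measure_pmf Q) (borel :: (real ^ 'n) measure) g"
  have g[measurable]: "g \<in> measurable (measure_pmf Q) borel" by simp
  interpret P: prob_space P unfolding P_def by (rule measure_pmf.prob_space_distr) simp
  have EQ: "(\<integral>f. h (f i) \<partial>measure_pmf Q) = (h True + c i * h False) / (1 + c i)"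
    for h :: "bool \<Rightarrow> real" and i
  proof -
    have "(\<integral>f. h (f i) \<partial>measure_pmf Q) = (\<integral>x. h x \<partial>measure_pmf (map_pmf (\<lambda>f. f i) Q))"
      by simp
    also have "map_pmf (\<lambda>f. f i) Q = bernoulli_pmf (1 / (1 + c i))"
      by (simp add: Q_def Pi_pmf_component)
    also have "(\<integral>x. h x \<partial>measure_pmf (bernoulli_pmf (1 / (1 + c i)))) = (h True + c i * h False) / (1 + c i)"
      by (simp add: c_def field_simps)
    finally show ?thesis .
  qed
  have EP: "(\<integral>\<epsilon>. h (\<epsilon> $ i) \<partial>P) = (h (c i) + c i * h (- 1)) / (1 + c i)"
    if [measurable]: "h \<in> borel_measurable borel" for h :: "real \<Rightarrow> real" and i
    using EQ[of "\<lambda>b. h (if b then c i else - 1)" i]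
    by (simp add: P_def integral_distr g_def X_def)
  have fin: "finite (set_pmf Q)" by (rule finite_subset[of _ UNIV]) auto
  have mean: "(\<integral>\<epsilon>. \<epsilon> $ i \<partial>P) = 0" for i using EP[of "\<lambda>x. x" i] by simp
  have "P.indep_vars (\<lambda>_. borel) (\<lambda>i \<epsilon>. \<epsilon> $ i) UNIV"
  proof (subst P.indep_vars_iff_distr_eq_PiM)
    have X: "prob_space.indep_vars (measure_pmf Q) (\<lambda>_. borel) X UNIV"
      using prob_space.indep_vars_compose2[OF measure_pmf.prob_space_axioms indep_vars_Pi_pmf[of UNIV False
        "\<lambda>i. bernoulli_pmf (1 / (1 + c i))", folded Q_def],
        of "\<lambda>i b. if b then c i else - 1" "\<lambda>_. borel"]
      by (simp add: X_def[abs_def])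
    \<comment> \<open>Independence is transferred through joint laws: the coordinates under
      \<open>P\<close> have the same joint law as the independent family \<open>X\<close> under
      \<open>Q\<close>.\<close>
    have "distr P (Pi\<^sub>M UNIV (\<lambda>_. borel)) (\<lambda>\<epsilon>. \<lambda>i\<in>UNIV. \<epsilon> $ i) =
        distr (measure_pmf Q) (Pi\<^sub>M UNIV (\<lambda>_. borel)) (\<lambda>f. \<lambda>i\<in>UNIV. X i f)"
    proof -
      have "(\<lambda>\<epsilon>. \<lambda>i\<in>UNIV. \<epsilon> $ i) \<circ> g = (\<lambda>f. \<lambda>i\<in>UNIV. X i f)"
        by (intro ext) (simp add: g_def restrict_def)
      then show ?thesis unfolding P_def by (subst distr_distr) auto
    qed
    also have "\<dots> = (\<Pi>\<^sub>M i\<in>UNIV. distr (measure_pmf Q) borel (X i))"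
      using X by (subst (asm) prob_space.indep_vars_iff_distr_eq_PiM[OF measure_pmf.prob_space_axioms]) auto
    also have "\<dots> = (\<Pi>\<^sub>M i\<in>UNIV. distr P borel (\<lambda>\<epsilon>. \<epsilon> $ i))"
      unfolding P_def by (subst distr_distr) (auto simp: comp_def g_def)
    finally show "distr P (Pi\<^sub>M UNIV (\<lambda>_. borel)) (\<lambda>\<epsilon>. \<lambda>i\<in>UNIV. \<epsilon> $ i) =
      (\<Pi>\<^sub>M i\<in>UNIV. distr P borel (\<lambda>\<epsilon>. \<epsilon> $ i))" .
  qed (auto simp: P_def)
  moreover have "integrable P (\<lambda>\<epsilon>. \<bar>\<epsilon> $ i\<bar> ^ 3)" for i
    unfolding P_def by (subst integrable_distr_eq) (auto intro: integrable_measure_pmf_finite fin)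
  moreover have "P.variance (\<lambda>\<epsilon>. \<epsilon> $ i) > 0" for i
    using EP[of "\<lambda>x. x\<^sup>2" i] by (simp add: mean c_def)
  ultimately have "noise_law P"
    using mean P.prob_space_axioms by (auto simp: noise_law_def P_def)
  moreover have "(\<integral>\<epsilon>. \<epsilon> $ i ^ 3 \<partial>P) = (if i \<in> K then 2 else 0)" for i
    using EP[of "\<lambda>x. x ^ 3" i] by (simp add: c_def)
  ultimately show ?thesis by blast
qed

lemma noise_second_moment_pos:
  assumes "noise_law P"
  shows "(\<integral>\<epsilon>. (\<epsilon> $ i)\<^sup>2 \<partial>P) > 0"
proof -
  have "(\<integral>\<epsilon>. (\<epsilon> $ i - (\<integral>\<epsilon>. \<epsilon> $ i \<partial>P))\<^sup>2 \<partial>P) > 0" "(\<integral>\<epsilon>. \<epsilon> $ i \<partial>P) = 0"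
    using assms unfolding noise_law_def by blast+
  then show ?thesis by simp
qed

lemma t_mom_eq_sum_support:
  fixes P :: "(real ^ 'n::finite) measure"
  assumes "noise_law P" "\<And>i. (\<integral>\<epsilon>. \<epsilon> $ i ^ 3 \<partial>P) = (if i \<in> K then 2 else 0)"
  shows "t_mom \<Lambda> P i j l = (\<Sum>k\<in>K. 2 * (matrix_inv (mat 1 - \<Lambda>) $ k $ i *
    matrix_inv (mat 1 - \<Lambda>) $ k $ j * matrix_inv (mat 1 - \<Lambda>) $ k $ l))"
  unfolding t_mom_eq[OF assms(1)] assms(2) by (intro sum.mono_neutral_cong_right) auto

section \<open>Vanishing and non-vanishing of the determinants\<close>

locale pair_digraph_on_finite_type = pair_wf_digraph G for G :: "('n::finite) pair_pre_digraph"

text \<open>A combination of columns \<open>u\<close> and \<open>v\<close> of the inverse is a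
  vector \<open>y\<close> for which \<open>?B *v y\<close> is supported on \<open>u\<close> and
  \<open>v\<close>. Choose \<open>y\<close> nonzero, supported on \<open>W\<close>, with
  \<open>?B *v y\<close> zero on \<open>W - {v}\<close>. Outside \<open>W\<close>, only
  \<open>u\<close> can have arcs into \<open>W\<close>, so the other rows vanish too. Nothing is
  divided by an entry of the inverse, and the coefficients are not both 0 because \<open>?B\<close>
  is injective.\<close>

lemma (in pair_digraph_on_finite_type) ex_relation_outside_closed:
  assumes \<Lambda>: "\<Lambda> \<in> edge_matrices G" and W: "v \<in> W" "u \<notin> W"
    and closed: "\<And>i j. (i, j) \<in> parcs G \<Longrightarrow> j \<in> W \<Longrightarrow> i \<noteq> u \<Longrightarrow> i \<in> W"
  shows "\<exists>\<alpha> \<beta>. (\<alpha> \<noteq> 0 \<or> \<beta> \<noteq> 0) \<and> (\<forall>i. i \<notin> W \<longrightarrow>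
    \<alpha> * matrix_inv (mat 1 - \<Lambda>) $ i $ u + \<beta> * matrix_inv (mat 1 - \<Lambda>) $ i $ v = 0)"
proof -
  let ?B = "mat 1 - \<Lambda>"
  have inv: "invertible ?B" using \<Lambda> by (simp add: edge_matrices_def)
  obtain y where y: "y \<noteq> 0" "\<And>w. w \<notin> W \<Longrightarrow> y $ w = 0" "\<And>w. w \<in> W - {v} \<Longrightarrow> (?B *v y) $ w = 0"
    using ex_kernel_vector_supported_on[OF W(1), of ?B] by blast
  define \<alpha> \<beta> where "\<alpha> = (?B *v y) $ u" and "\<beta> = (?B *v y) $ v"
  have "(?B *v y) $ w = (\<alpha> *\<^sub>R axis u 1 + \<beta> *\<^sub>R axis v 1) $ w" for w
  proof -
    have "(?B *v y) $ w = 0" if w: "w \<notin> W" "w \<noteq> u"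
    proof -
      have "?B $ w $ j * y $ j = 0" for j
        using closed[of w j] w y(2)[of j] \<Lambda>
        by (cases "j \<in> W") (auto simp: edge_matrices_def mat_def)
      then show ?thesis by (simp add: matrix_vector_mult_def sum.neutral)
    qed
    then show ?thesis
      using W y(3)[of w] by (auto simp: \<alpha>_def \<beta>_def axis_def)
  qed
  then have By: "?B *v y = \<alpha> *\<^sub>R axis u 1 + \<beta> *\<^sub>R axis v 1" by (simp add: vec_eq_iff)
  have yA: "y = matrix_inv ?B *v (?B *v y)"
    by (simp add: matrix_vector_mul_assoc matrix_inv_mult[OF inv])
  have "y $ i = \<alpha> * matrix_inv ?B $ i $ u + \<beta> * matrix_inv ?B $ i $ v" for i
    by (subst yA) (simp add: By matrix_vector_right_distrib matrix_vector_mult_scaleR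
        matrix_vector_mult_basis column_def)
  moreover have "\<alpha> \<noteq> 0 \<or> \<beta> \<noteq> 0" using y(1) yA By by auto
  ultimately show ?thesis using y(2) by metis
qed

text \<open>The Neumann series of the inverse would show this but need not converge. Instead, no arc
  leads from a non-ancestor of \<open>u\<close> to an ancestor, which is the block structure
  required for solving for column \<open>u\<close>.\<close>

lemma (in pair_digraph_on_finite_type) matrix_inv_eq_0_if_not_ancestor:
  assumes \<Lambda>: "\<Lambda> \<in> edge_matrices G" and "u \<in> pverts G" "\<not> ancestor G i u"
  shows "matrix_inv (mat 1 - \<Lambda>) $ i $ u = 0"
proof -
  let ?B = "mat 1 - \<Lambda>" and ?R = "{a. ancestor G a u}"
  have inv: "invertible ?B" using \<Lambda> by (simp add: edge_matrices_def)
  have "u \<in> ?R" using assms(2) by (auto simp: ancestor_def apath_Nil_iff intro: exI[of _ "[]"])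
  have "column u (matrix_inv ?B) $ i = 0"
  proof (rule linear_solution_supported_on[OF inv _ matrix_inv_column[OF inv], of ?R])
    show "?B $ k $ j = 0" if "k \<notin> ?R" "j \<in> ?R" for k j
      using that \<Lambda> apath_extend[of k j _ u]
      by (auto simp: ancestor_def edge_matrices_def mat_def)
    show "axis u 1 $ k = (0 :: real)" if "k \<notin> ?R" for k
      using that \<open>u \<in> ?R\<close> by (auto simp: axis_def)
  qed (use assms(3) in simp)
  then show ?thesis by (simp add: column_def)
qed

section \<open>The 0-1 matrix of a simple trek\<close>

lemma (in pair_digraph_on_finite_type) trek_matrix_column:
  fixes \<Lambda> :: "real ^ 'n ^ 'n"
  assumes p: "apath t p u" and q: "apath t q v"
    and int: "set (pawalk_verts t p) \<inter> set (pawalk_verts t q) = {t}"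
    and \<Lambda>: "\<And>i j. \<Lambda> $ i $ j = (if (i, j) \<in> set p \<or> (i, j) \<in> set q then 1 else 0)"
    and inv: "invertible (mat 1 - \<Lambda>)"
  shows "matrix_inv (mat 1 - \<Lambda>) $ k $ u = of_bool (k \<in> set (pawalk_verts t p))"
proof -
  \<comment> \<open>Entry \<open>k\<close> should count the paths from \<open>k\<close> to
    \<open>u\<close> inside the trek: one if \<open>k\<close> lies on \<open>p\<close>, none
    otherwise.\<close>
  let ?x = "(\<chi> k. of_bool (k \<in> set (pawalk_verts t p))) :: real ^ 'n"
  have "((mat 1 - \<Lambda>) *v ?x) $ w = axis u 1 $ w" for w
  proof -
    \<comment> \<open>Arcs of \<open>q\<close> contribute nothing: their heads lie on
      \<open>q\<close> and differ from \<open>t\<close>, hence lie off \<open>p\<close>.\<close>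
    have "\<Lambda> $ w $ j * ?x $ j = of_bool (j \<in> {j. (w, j) \<in> set p})" for j
      using apath_arcs(2)[OF p] apath_arcs(2)[OF q] int by (auto simp: \<Lambda>)
    then have "(\<Lambda> *v ?x) $ w = (\<Sum>j\<in>UNIV. of_bool (j \<in> {j. (w, j) \<in> set p}))"
      by (simp only: matrix_vector_mult_def vec_lambda_beta)
    also have "\<dots> = real (card {j. (w, j) \<in> set p})" by simp
    also have "\<dots> = of_bool (w \<in> set (pawalk_verts t p) - {u})"
      by (subst apath_arcs(3)[OF p]) simp
    finally have "(\<Lambda> *v ?x) $ w = of_bool (w \<in> set (pawalk_verts t p) - {u})" .
    then show ?thesis
      using apath_ends_mem(2)[OF p] by (auto simp: matrix_vector_mult_diff_rdistrib axis_def)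
  qed
  then have "(mat 1 - \<Lambda>) *v ?x = axis u 1" by (simp add: vec_eq_iff)
  from matrix_inv_column_unique[OF inv this] show ?thesis by simp
qed

lemma (in pair_digraph_on_finite_type) ex_trek_matrix:
  assumes "simple_two_trek G t p q u v"
  shows "\<exists>\<Lambda>\<in>edge_matrices G. \<forall>k.
    matrix_inv (mat 1 - \<Lambda>) $ k $ u = of_bool (k \<in> set (pawalk_verts t p)) \<and>
    matrix_inv (mat 1 - \<Lambda>) $ k $ v = of_bool (k \<in> set (pawalk_verts t q))"
proof -
  have p: "apath t p u" and q: "apath t q v"
    and int: "set (pawalk_verts t p) \<inter> set (pawalk_verts t q) = {t}"
    using assms by (auto simp: simple_two_trek_def two_trek_def)
  define \<Lambda> :: "real ^ 'n ^ 'n" where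
    "\<Lambda> = (\<chi> i j. if (i, j) \<in> set p \<or> (i, j) \<in> set q then 1 else 0)"
  obtain r r' :: "'n \<Rightarrow> nat" where
    r: "r t = 0" "\<And>x y. (x, y) \<in> set p \<Longrightarrow> r x < r y" and
    r': "r' t = 0" "\<And>x y. (x, y) \<in> set q \<Longrightarrow> r' x < r' y"
    using apath_rank[OF p] apath_rank[OF q] by blast
  have inv: "invertible (mat 1 - \<Lambda>)"
  proof (rule invertible_mat_minus_acyclic)
    \<comment> \<open>The two ranks can be glued because both are 0 at the top, the only common
      vertex.\<close>
    let ?r = "\<lambda>w. if w \<in> set (pawalk_verts t p) then r w else r' w"
    fix i j assume "\<Lambda> $ i $ j \<noteq> 0"
    then consider "(i, j) \<in> set p" | "(i, j) \<in> set q" by (auto simp: \<Lambda>_def split: if_splits)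
    then show "?r i < ?r j"
    proof cases
      case 1
      then show ?thesis using apath_arcs(2)[OF p] r by auto
    next
      case 2
      then have "i \<in> set (pawalk_verts t q)" "j \<in> set (pawalk_verts t q)" "j \<noteq> t"
        using apath_arcs(2)[OF q] by auto
      then have "j \<notin> set (pawalk_verts t p)" "i \<in> set (pawalk_verts t p) \<Longrightarrow> i = t"
        using int by auto
      then show ?thesis using r(1) r'(1) r'(2)[OF 2] by auto
    qed
  qed
  have "\<Lambda> \<in> edge_matrices G"
    using inv apath_arcs(1)[OF p] apath_arcs(1)[OF q] by (auto simp: edge_matrices_def \<Lambda>_def)
  moreover have "matrix_inv (mat 1 - \<Lambda>) $ k $ u = of_bool (k \<in> set (pawalk_verts t p))" for k
    by (rule trek_matrix_column[OF p q int _ inv]) (simp add: \<Lambda>_def)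
  moreover have "matrix_inv (mat 1 - \<Lambda>) $ k $ v = of_bool (k \<in> set (pawalk_verts t q))" for k
    by (rule trek_matrix_column[OF q p _ _ inv]) (use int in \<open>auto simp: \<Lambda>_def\<close>)
  ultimately show ?thesis by blast
qed

section \<open>Criteria for vanishing\<close>

lemma d2x2_eq_0_if_linear_relation:
  assumes P: "noise_law P" and nz: "\<alpha> \<noteq> 0 \<or> \<beta> \<noteq> 0"
    and rel: "\<And>i. matrix_inv (mat 1 - \<Lambda>) $ i $ u = 0 \<or>
      \<alpha> * matrix_inv (mat 1 - \<Lambda>) $ i $ u + \<beta> * matrix_inv (mat 1 - \<Lambda>) $ i $ v = 0"
  shows "d2x2 \<Lambda> P u v = 0"
proof -
  let ?A = "matrix_inv (mat 1 - \<Lambda>)"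
  \<comment> \<open>Every entry of the matrix is a weighted sum of monomials divisible by a_i.
    Applied to the vector of coefficients, each row therefore becomes a weighted sum of multiples of
    these products.\<close>
  have rel': "?A $ i $ u * (\<alpha> * ?A $ i $ u + \<beta> * ?A $ i $ v) = 0" for i using rel[of i] by auto
  have "s_mom \<Lambda> P u u * \<alpha> + s_mom \<Lambda> P u v * \<beta> = (\<Sum>k\<in>UNIV. (\<integral>\<epsilon>. (\<epsilon> $ k)\<^sup>2 \<partial>P) *
      (?A $ k $ u * (\<alpha> * ?A $ k $ u + \<beta> * ?A $ k $ v)))"
    unfolding s_mom_eq[OF P] sum_distrib_right sum.distrib[symmetric]
    by (intro sum.cong refl) (simp add: algebra_simps)
  moreover have "t_mom \<Lambda> P u u u * \<alpha> + t_mom \<Lambda> P u u v * \<beta> = (\<Sum>k\<in>UNIV. (\<integral>\<epsilon>. \<epsilon> $ k ^ 3 \<partial>P) *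
      (?A $ k $ u * (?A $ k $ u * (\<alpha> * ?A $ k $ u + \<beta> * ?A $ k $ v))))"
    unfolding t_mom_eq[OF P] sum_distrib_right sum.distrib[symmetric]
    by (intro sum.cong refl) (simp add: algebra_simps)
  ultimately show ?thesis
    using nz unfolding d2x2_def Let_def
    by (intro det_eq_0_if_kernel[where c = "vector [\<alpha>, \<beta>]"])
      (auto simp: vec_eq_iff forall_2 matrix_vector_mult_def sum_2 vector_2 rel' simp del: mult_eq_0_iff)
qed

text \<open>The kernel vector consists of the coefficients of the product of the two linear forms.
  The three rows pair with it to weighted sums of this quadratic form, of a_i times it and of b_i
  times it.\<close>

lemma d3x3_eq_0_if_two_linear_relations:
  assumes P: "noise_law P" and nz: "\<alpha> \<noteq> 0 \<or> \<beta> \<noteq> 0" "\<gamma> \<noteq> 0 \<or> \<delta> \<noteq> 0"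
    and rel: "\<And>i.
      \<alpha> * matrix_inv (mat 1 - \<Lambda>) $ i $ u + \<beta> * matrix_inv (mat 1 - \<Lambda>) $ i $ v = 0 \<or>
      \<gamma> * matrix_inv (mat 1 - \<Lambda>) $ i $ u + \<delta> * matrix_inv (mat 1 - \<Lambda>) $ i $ v = 0"
  shows "d3x3 \<Lambda> P u v = 0"
proof -
  let ?A = "matrix_inv (mat 1 - \<Lambda>)"
  let ?Q = "\<lambda>i. (\<alpha> * ?A $ i $ u + \<beta> * ?A $ i $ v) * (\<gamma> * ?A $ i $ u + \<delta> * ?A $ i $ v)"
  have Q: "?Q i = 0" for i using rel[of i] by auto
  have "s_mom \<Lambda> P u u * (\<alpha> * \<gamma>) + s_mom \<Lambda> P u v * (\<alpha> * \<delta> + \<beta> * \<gamma>) + s_mom \<Lambda> P v v * (\<beta> * \<delta>) =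
      (\<Sum>k\<in>UNIV. (\<integral>\<epsilon>. (\<epsilon> $ k)\<^sup>2 \<partial>P) * ?Q k)"
    unfolding s_mom_eq[OF P] sum_distrib_right sum.distrib[symmetric]
    by (intro sum.cong refl) (simp add: algebra_simps)
  moreover have "t_mom \<Lambda> P u u u * (\<alpha> * \<gamma>) + t_mom \<Lambda> P u u v * (\<alpha> * \<delta> + \<beta> * \<gamma>) +
      t_mom \<Lambda> P u v v * (\<beta> * \<delta>) = (\<Sum>k\<in>UNIV. (\<integral>\<epsilon>. \<epsilon> $ k ^ 3 \<partial>P) * (?A $ k $ u * ?Q k))"
    unfolding t_mom_eq[OF P] sum_distrib_right sum.distrib[symmetric]
    by (intro sum.cong refl) (simp add: algebra_simps)
  moreover have "t_mom \<Lambda> P u u v * (\<alpha> * \<gamma>) + t_mom \<Lambda> P u v v * (\<alpha> * \<delta> + \<beta> * \<gamma>) +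
      t_mom \<Lambda> P v v v * (\<beta> * \<delta>) = (\<Sum>k\<in>UNIV. (\<integral>\<epsilon>. \<epsilon> $ k ^ 3 \<partial>P) * (?A $ k $ v * ?Q k))"
    unfolding t_mom_eq[OF P] sum_distrib_right sum.distrib[symmetric]
    by (intro sum.cong refl) (simp add: algebra_simps)
  \<comment> \<open>A product of nonzero polynomials is nonzero.\<close>
  moreover have "vector [\<alpha> * \<gamma>, \<alpha> * \<delta> + \<beta> * \<gamma>, \<beta> * \<delta>] \<noteq> (0 :: real ^ 3)"
    using nz by (auto simp: vec_eq_iff forall_3 vector_3)
  ultimately show ?thesis
    unfolding d3x3_def Let_def Q
    by (intro det_eq_0_if_kernel[where c = "vector [\<alpha> * \<gamma>, \<alpha> * \<delta> + \<beta> * \<gamma>, \<beta> * \<delta>]"])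
      (auto simp: vec_eq_iff forall_3 matrix_vector_mult_def sum_3 vector_3)
qed

section \<open>Witnesses for non-vanishing\<close>

lemma (in pair_digraph_on_finite_type) ex_d2x2_ne_0:
  assumes trek: "simple_two_trek G t p q u v" "p \<noteq> []"
  shows "\<exists>\<Lambda>\<in>edge_matrices G. \<exists>P. noise_law P \<and> d2x2 \<Lambda> P u v \<noteq> 0"
proof -
  have p: "apath t p u" and q: "apath t q v"
    and int: "set (pawalk_verts t p) \<inter> set (pawalk_verts t q) = {t}"
    using trek by (auto simp: simple_two_trek_def two_trek_def)
  have "t \<noteq> u" using apath_nonempty_ends[OF p trek(2)] .
  then have uq: "u \<notin> set (pawalk_verts t q)" using int apath_ends_mem(2)[OF p] by auto
  obtain \<Lambda> where \<Lambda>: "\<Lambda> \<in> edge_matrices G"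
    and Au: "\<And>k. matrix_inv (mat 1 - \<Lambda>) $ k $ u = of_bool (k \<in> set (pawalk_verts t p))"
    and Av: "\<And>k. matrix_inv (mat 1 - \<Lambda>) $ k $ v = of_bool (k \<in> set (pawalk_verts t q))"
    using ex_trek_matrix[OF trek(1)] by blast
  \<comment> \<open>Skewness at the top alone makes both third moments equal, since a_t = b_t = 1.
    What remains is a multiple of s_uu - s_uv, the total variance at the nodes on \<open>p\<close>
    but not on \<open>q\<close>, and \<open>u\<close> is one of these.\<close>
  obtain P where P: "noise_law P" "\<And>i. (\<integral>\<epsilon>. \<epsilon> $ i ^ 3 \<partial>P) = (if i \<in> {t} then 2 else 0)"
    using ex_noise_law_third_moments[of "{t}"] by blast
  have "t_mom \<Lambda> P u u u = 2" "t_mom \<Lambda> P u u v = 2"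
    using apath_ends_mem(1)[OF p] apath_ends_mem(1)[OF q]
    by (simp_all add: t_mom_eq_sum_support[OF P] Au Av)
  then have "d2x2 \<Lambda> P u v = 2 * (s_mom \<Lambda> P u u - s_mom \<Lambda> P u v)"
    by (simp add: d2x2_def Let_def det_2 vector_2)
  moreover have "s_mom \<Lambda> P u u - s_mom \<Lambda> P u v = (\<Sum>k\<in>UNIV. (\<integral>\<epsilon>. (\<epsilon> $ k)\<^sup>2 \<partial>P) *
      of_bool (k \<in> set (pawalk_verts t p) - set (pawalk_verts t q)))"
    unfolding s_mom_eq[OF P(1)] sum_subtractf[symmetric] Au Av by (intro sum.cong refl) auto
  moreover have "\<dots> > 0"
    using noise_second_moment_pos[OF P(1)] uq apath_ends_mem(2)[OF p]
    by (intro sum_pos2[of _ u]) (auto simp: less_imp_le)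
  ultimately show ?thesis using \<Lambda> P(1) by force
qed

lemma (in pair_digraph_on_finite_type) ex_d3x3_ne_0:
  assumes trek: "simple_two_trek G t p q u v" "p \<noteq> []" "q \<noteq> []"
  shows "\<exists>\<Lambda>\<in>edge_matrices G. \<exists>P. noise_law P \<and> d3x3 \<Lambda> P u v \<noteq> 0"
proof -
  have p: "apath t p u" and q: "apath t q v"
    and int: "set (pawalk_verts t p) \<inter> set (pawalk_verts t q) = {t}"
    using trek by (auto simp: simple_two_trek_def two_trek_def)
  have "t \<noteq> u" "t \<noteq> v" using apath_nonempty_ends[OF p trek(2)] apath_nonempty_ends[OF q trek(3)] .
  then have mem: "u \<notin> set (pawalk_verts t q)" "v \<notin> set (pawalk_verts t p)"
    "u \<in> set (pawalk_verts t p)" "v \<in> set (pawalk_verts t q)"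
    using int apath_ends_mem(2)[OF p] apath_ends_mem(2)[OF q] by auto
  obtain \<Lambda> where \<Lambda>: "\<Lambda> \<in> edge_matrices G"
    and Au: "\<And>k. matrix_inv (mat 1 - \<Lambda>) $ k $ u = of_bool (k \<in> set (pawalk_verts t p))"
    and Av: "\<And>k. matrix_inv (mat 1 - \<Lambda>) $ k $ v = of_bool (k \<in> set (pawalk_verts t q))"
    using ex_trek_matrix[OF trek(1)] by blast
  \<comment> \<open>Skewness at \<open>u\<close> and \<open>v\<close> only kills the mixed third
    moments, because neither node lies on the other side of the trek. The determinant reduces to a
    multiple of s_uv, to which the top contributes its variance.\<close>
  obtain P where P: "noise_law P" "\<And>i. (\<integral>\<epsilon>. \<epsilon> $ i ^ 3 \<partial>P) = (if i \<in> {u, v} then 2 else 0)"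
    using ex_noise_law_third_moments[of "{u, v}"] by blast
  have "u \<noteq> v" using mem by auto
  then have "t_mom \<Lambda> P u u u = 2" "t_mom \<Lambda> P u u v = 0" "t_mom \<Lambda> P u v v = 0" "t_mom \<Lambda> P v v v = 2"
    using mem by (simp_all add: t_mom_eq_sum_support[OF P] Au Av)
  then have "d3x3 \<Lambda> P u v = - 4 * s_mom \<Lambda> P u v"
    by (simp add: d3x3_def Let_def det_3 vector_3)
  moreover have "s_mom \<Lambda> P u v > 0"
    unfolding s_mom_eq[OF P(1)] Au Av
    using noise_second_moment_pos[OF P(1)] int
    by (intro sum_pos2[of _ t]) (auto simp: less_imp_le)
  ultimately show ?thesis using \<Lambda> P(1) by force
qed

theorem theorem4p3:
  fixes G :: "('n::finite) pair_pre_digraph" and u v :: 'n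
  assumes "pair_digraph G" and "pverts G = UNIV" and "cycle_disjoint G" and "u \<noteq> v"
  shows "((\<forall>\<Lambda>\<in>edge_matrices G. \<forall>P. noise_law P \<longrightarrow> d2x2 \<Lambda> P u v = 0) \<longleftrightarrow>
            (\<nexists>a. common_ancestor G a u v) \<and> \<not> ancestor G v u) \<and>
         ((\<forall>\<Lambda>\<in>edge_matrices G. \<forall>P. noise_law P \<longrightarrow> d3x3 \<Lambda> P u v = 0) \<longleftrightarrow>
            (\<nexists>t Pu Pv. simple_two_trek G t Pu Pv u v \<and> Pu \<noteq> [] \<and> Pv \<noteq> []))"
proof -
  interpret pair_digraph G by fact
  interpret pair_digraph_on_finite_type G by unfold_locales
  \<comment> \<open>The complement of \<open>W x y\<close> consists of the nodes all of whose paths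
    to \<open>y\<close> run through \<open>x\<close>; there columns \<open>x\<close> and
    \<open>y\<close> satisfy one common relation.\<close>
  define W where "W x y = {w. \<exists>q. apath w q y \<and> x \<notin> set (pawalk_verts w q)}" for x y
  have rel: "\<exists>\<alpha> \<beta>. (\<alpha> \<noteq> 0 \<or> \<beta> \<noteq> 0) \<and> (\<forall>i. i \<notin> W x y \<longrightarrow>
      \<alpha> * matrix_inv (mat 1 - \<Lambda>) $ i $ x + \<beta> * matrix_inv (mat 1 - \<Lambda>) $ i $ y = 0)"
    if "\<Lambda> \<in> edge_matrices G" "x \<noteq> y" for \<Lambda> x y
  proof (rule ex_relation_outside_closed[OF that(1)])
    show "y \<in> W x y"
      using that assms(2) by (auto simp: W_def apath_Nil_iff intro!: exI[of _ "[]"])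
    show "x \<notin> W x y" using apath_ends_mem(1) by (auto simp: W_def)
    show "i \<in> W x y" if "(i, j) \<in> parcs G" "j \<in> W x y" "i \<noteq> x" for i j
      using that apath_extend[OF that(1)] unfolding W_def by blast
  qed
  have confounder: "common_ancestor G i u v \<longleftrightarrow> i \<in> W u v \<and> i \<in> W v u" for i
    by (auto simp: common_ancestor_def W_def)
  have a1: "(\<nexists>a. common_ancestor G a u v) \<and> \<not> ancestor G v u"
    if "\<forall>\<Lambda>\<in>edge_matrices G. \<forall>P. noise_law P \<longrightarrow> d2x2 \<Lambda> P u v = 0"
  proof -
    have no_trek: "p = []" if "simple_two_trek G t p q u v" for t p q
      using ex_d2x2_ne_0[OF that] \<open>\<forall>\<Lambda>\<in>edge_matrices G. _ \<Lambda>\<close> by blast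
    have "\<not> ancestor G v u"
    proof
      assume "ancestor G v u"
      then obtain p where p: "apath v p u" by (auto simp: ancestor_def)
      \<comment> \<open>The 2x2 witness allows an empty second side, so a path from \<open>v\<close>
        to \<open>u\<close> suffices.\<close>
      then have "simple_two_trek G v p [] u v"
        using apath_ends_mem(1)[OF p] assms(2)
        by (auto simp: simple_two_trek_def two_trek_def apath_Nil_iff)
      then have "p = []" by (rule no_trek)
      with p assms(4) show False by (auto simp: apath_Nil_iff)
    qed
    with no_trek show ?thesis using ex_common_ancestor_iff_simple_two_trek by blast
  qed
  have a2: "d2x2 \<Lambda> P u v = 0"
    if no: "\<nexists>a. common_ancestor G a u v" "\<not> ancestor G v u"
      and \<Lambda>: "\<Lambda> \<in> edge_matrices G" and P: "noise_law P" for \<Lambda> P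
  proof -
    \<comment> \<open>No path to \<open>u\<close> meets \<open>v\<close>, as its suffix would make
      \<open>v\<close> an ancestor of \<open>u\<close>. So an ancestor of \<open>u\<close> with a
      path to \<open>v\<close> avoiding \<open>u\<close> would be a confounder. All other nodes have
      a_i = 0.\<close>
    have "i \<notin> W u v" if "ancestor G i u" for i
    proof -
      from that obtain p where p: "apath i p u" by (auto simp: ancestor_def)
      then have "v \<notin> set (pawalk_verts i p)"
        using apath_suffix[OF p] no(2) by (auto simp: ancestor_def)
      with p have "i \<in> W v u" by (auto simp: W_def)
      with no(1) confounder show ?thesis by blast
    qed
    then have "matrix_inv (mat 1 - \<Lambda>) $ i $ u = 0 \<or> i \<notin> W u v" for i
      using matrix_inv_eq_0_if_not_ancestor[OF \<Lambda>, of u i] assms(2) by auto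
    with rel[OF \<Lambda> assms(4)] d2x2_eq_0_if_linear_relation[OF P] show ?thesis by metis
  qed
  have b1: "\<nexists>t Pu Pv. simple_two_trek G t Pu Pv u v \<and> Pu \<noteq> [] \<and> Pv \<noteq> []"
    if "\<forall>\<Lambda>\<in>edge_matrices G. \<forall>P. noise_law P \<longrightarrow> d3x3 \<Lambda> P u v = 0"
    using ex_d3x3_ne_0 that by blast
  have b2: "d3x3 \<Lambda> P u v = 0"
    if no: "\<nexists>t Pu Pv. simple_two_trek G t Pu Pv u v \<and> Pu \<noteq> [] \<and> Pv \<noteq> []"
      and \<Lambda>: "\<Lambda> \<in> edge_matrices G" and P: "noise_law P" for \<Lambda> P
  proof -
    let ?A = "matrix_inv (mat 1 - \<Lambda>)"
    have "i \<notin> W u v \<or> i \<notin> W v u" for i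
      using no ex_common_ancestor_iff_simple_two_trek[of u v] confounder by blast
    moreover obtain \<alpha> \<beta> where "\<alpha> \<noteq> 0 \<or> \<beta> \<noteq> 0"
      "\<And>i. i \<notin> W u v \<Longrightarrow> \<alpha> * ?A $ i $ u + \<beta> * ?A $ i $ v = 0"
      using rel[OF \<Lambda> assms(4)] by blast
    \<comment> \<open>With \<open>u\<close> and \<open>v\<close> exchanged, the coefficient of
      column \<open>v\<close> comes first.\<close>
    moreover obtain \<gamma> \<delta> where "\<gamma> \<noteq> 0 \<or> \<delta> \<noteq> 0"
      "\<And>i. i \<notin> W v u \<Longrightarrow> \<delta> * ?A $ i $ v + \<gamma> * ?A $ i $ u = 0"
      using rel[OF \<Lambda> assms(4)[symmetric]] by blast
    ultimately show ?thesis
      by (intro d3x3_eq_0_if_two_linear_relations[OF P, of \<alpha> \<beta> \<gamma> \<delta>]) (auto simp: add.commute)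
  qed
  show ?thesis using a1 a2 b1 b2 by blast
qed

end
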